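(* Let $n\ge1$ be an integer and $$G_n(x)=\sum_{k=0}^\infty\left(\binom{n+k-1}{k}x^k(1+x)^{-n-k}\right)^2,\quad x\in[0,+\infty).$$ (a) For all $x\ge0$, $$x(1+x)(1+2x)G_n''(x)+\bigl(4(n+1)x(1+x)+1\bigr)G_n'(x)+2n(1+2x)G_n(x)=0,$$ $$G_n(x)=\frac1\pi\int_0^1\left(t+(1-t)(1+2x)^2\right)^{-n}\frac{dt}{\sqrt{t(1-t)}},$$ $$G_n(x)\le\bigl(4(n+1)x(1+x)+1\bigr)^{-\frac{n}{2(n+1)}}.$$ (b) The function $y(x)=G_n(-x)$ is a rational solution to the Heun equation $$y''(x)+\left(\frac1x+\frac1{x-1}+\frac{2n}{x-\frac12}\right)y'(x)+\frac{2nx-n}{x(x-1)\left(x-\frac12\right)}y(x)=0,\quad x<0,$$ with singular point $a=\frac12$ and parameters $\alpha=1$, $\beta=2n$, $\gamma=1$, $\delta=1$, $\epsilon=2n$, $q=n$.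
   Context: The convention $0^0=1$ is used; derivatives at $x=0$ are one-sided. A rational solution means one that coincides on $x<0$ with a rational function of $x$. The Heun equation with singular points $0,1,a$ and parameters $\alpha,\beta,\gamma,\delta,\epsilon,q$ (with $\gamma+\delta+\epsilon=\alpha+\beta+1$) is $$y''+\left(\frac{\gamma}{x}+\frac{\delta}{x-1}+\frac{\epsilon}{x-a}\right)y'+\frac{\alpha\beta x-q}{x(x-1)(x-a)}y=0.$$ *)

theory Defs
  imports "HOL-Analysis.Analysis" "HOL-Computational_Algebra.Polynomial"
begin

definition G :: "nat \<Rightarrow> real \<Rightarrow> real" where
  "G n x = (\<Sum>k. (real ((n + k - 1) choose k) * x ^ k * (1 + x) powi (- int n - int k))\<^sup>2)"

text \<open>The series converges on the whole domain \<open>[0,\<infinity>)\<close>, so the value of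
  \<^const>\<open>suminf\<close> there is a genuine sum.\<close>

lemma G_summable:
  assumes "n \<ge> 1" and "x \<ge> 0"
  shows "summable (\<lambda>k. (real ((n + k - 1) choose k) * x ^ k * (1 + x) powi (- int n - int k))\<^sup>2)"
proof -
  define r where "r = x / (1 + x)"
  have r: "0 \<le> r" "r < 1" using assms by (auto simp: r_def)
  define b where "b = (\<lambda>k. real ((n + k - 1) choose k) * r ^ k)"
  have b_nonneg: "b k \<ge> 0" for k using r by (simp add: b_def)
  have term_eq: "((- real n) gchoose k) * (- r) ^ k = b k" for k
  proof -
    have "(real n + real k - 1) gchoose k = real ((n + k - 1) choose k)"
      using assms by (simp add: binomial_gbinomial of_nat_diff)
    then have 1: "((- real n) gchoose k) = (- 1) ^ k * real ((n + k - 1) choose k)"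
      using gbinomial_minus[of "real n" k] by simp
    have "(- 1 :: real) ^ k * (- r) ^ k = r ^ k"
      using power_mult_distrib[of "- 1" "- r" k] by simp
    then show ?thesis
      unfolding 1 b_def by (metis mult.assoc mult.commute)
  qed
  have "(\<lambda>k. ((- real n) gchoose k) * (- r) ^ k) sums (1 + (- r)) powr (- real n)"
    by (rule gen_binomial_real) (use r in simp)
  then have sb: "summable b"
    unfolding term_eq by (rule sums_summable)
  then have "eventually (\<lambda>k. b k < 1) sequentially"
    by (intro order_tendstoD(2)[OF summable_LIMSEQ_zero]) simp_all
  then have "eventually (\<lambda>k. norm ((b k)\<^sup>2) \<le> b k) sequentially"
  proof eventually_elim
    case (elim k)
    then have "b k * b k \<le> b k * 1" using b_nonneg[of k] by (intro mult_left_mono) auto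
    then show ?case by (simp add: power2_eq_square)
  qed
  then have s2: "summable (\<lambda>k. (b k)\<^sup>2)"
    using sb by (rule summable_comparison_test_ev)
  have "real ((n + k - 1) choose k) * x ^ k * (1 + x) powi (- int n - int k) = b k * inverse ((1 + x) ^ n)" for k
  proof -
    have "- int n - int k = - int (n + k)" by simp
    then have "(1 + x) powi (- int n - int k) = inverse ((1 + x) ^ (n + k))"
      by (simp only: power_int_minus power_int_of_nat)
    then show ?thesis by (simp add: b_def r_def power_add power_inverse power_mult_distrib divide_inverse)
  qed
  then show ?thesis
    using summable_mult2[OF s2, of "(inverse ((1 + x) ^ n))\<^sup>2"] by (simp add: power_mult_distrib)
qed

text \<open>Derivatives are taken within \<open>S\<close>, hence are one-sided at a boundary point of an interval
  \<open>S\<close> and ordinary at its interior points.\<close>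

definition has_two_derivs_on ::
    "real set \<Rightarrow> (real \<Rightarrow> real) \<Rightarrow> (real \<Rightarrow> real) \<Rightarrow> (real \<Rightarrow> real) \<Rightarrow> bool" where
  "has_two_derivs_on S f f' f'' \<longleftrightarrow>
     (\<forall>x\<in>S. (f has_real_derivative f' x) (at x within S) \<and>
            (f' has_real_derivative f'' x) (at x within S))"

definition heun_solution_on ::
    "real set \<Rightarrow> real \<Rightarrow> real \<Rightarrow> real \<Rightarrow> real \<Rightarrow> real \<Rightarrow> real \<Rightarrow> real \<Rightarrow> (real \<Rightarrow> real) \<Rightarrow> bool" where
  "heun_solution_on S a \<alpha> \<beta> \<gamma> \<delta> \<epsilon> q y \<longleftrightarrow>
     \<gamma> + \<delta> + \<epsilon> = \<alpha> + \<beta> + 1 \<and> a \<noteq> 0 \<and> a \<noteq> 1 \<and> S \<inter> {0, 1, a} = {} \<and>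
     (\<exists>y' y''. has_two_derivs_on S y y' y'' \<and>
        (\<forall>x\<in>S. y'' x + (\<gamma> / x + \<delta> / (x - 1) + \<epsilon> / (x - a)) * y' x +
                (\<alpha> * \<beta> * x - q) / (x * (x - 1) * (x - a)) * y x = 0))"

definition rational_on :: "real set \<Rightarrow> (real \<Rightarrow> real) \<Rightarrow> bool" where
  "rational_on S f \<longleftrightarrow>
     (\<exists>p q :: real poly. q \<noteq> 0 \<and> (\<forall>x\<in>S. poly q x \<noteq> 0 \<and> f x = poly p x / poly q x))"

end

theory Submission
  imports Defs
begin

text \<open>In terms of \<open>w = (x / (1 + x))\<^sup>2\<close> the series is \<open>(1 + x) powi (- 2 * n)\<close> times the
  hypergeometric series \<open>\<^sub>2F\<^sub>1(n, n; 1; w)\<close>, so the hypergeometric equation becomes the differential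
  equation of \<open>G n\<close>. In terms of \<open>c = 1 + 2 * x\<close> that equation has the solution
  \<open>\<Sum>j\<le>m. a\<^sub>j / c ^ (2 * j + 1)\<close> with \<open>m = n - 1\<close> and \<open>a\<^sub>j\<close> the binomial coefficient times a moment
  of the arcsine law. The Wronskian of two solutions, multiplied by the coefficient
  \<open>x * (1 + x) * (1 + 2 * x) ^ (2 * n)\<close> of the self-adjoint form, is constant and vanishes at the
  singular point 0; hence the two solutions coincide on \<open>[0,\<infinity>)\<close>. The substitution
  \<open>u = t / (t + (1 - t) * c\<^sup>2)\<close> turns the integral into the integral of a polynomial against the
  arcsine law. Since all \<open>a\<^sub>j\<close> are nonnegative the solution is convex, which yields the upper
  bound.\<close>

section \<open>Inverse powers and moments of the arcsine law\<close>

lemma has_real_derivative_inverse_power: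
  fixes c :: real
  assumes "c \<noteq> 0"
  shows "((\<lambda>c. inverse (c ^ k)) has_real_derivative - real k * inverse (c ^ Suc k)) (at c)"
proof (cases k)
  case (Suc j)
  have "((\<lambda>c. inverse c ^ k) has_real_derivative
      real k * (- (inverse c * 1 * inverse c) * inverse c ^ (k - Suc 0))) (at c)"
    using DERIV_power[OF DERIV_inverse_fun[OF DERIV_ident assms]] by simp
  then show ?thesis
    by (simp add: Suc power_inverse[symmetric] algebra_simps del: power_inverse)
qed simp

text \<open>The mean of \<open>u ^ i * (1 - u) ^ j\<close> under the arcsine law, whose density on
  [0,1] is \<open>1 / (pi * sqrt (u * (1 - u)))\<close>.\<close>

definition arcsine_moment :: "nat \<Rightarrow> nat \<Rightarrow> real" where
  "arcsine_moment i j = Beta (real i + 1 / 2) (real j + 1 / 2) / pi"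

lemma arcsine_moment_pos: "arcsine_moment i j > 0"
  by (auto simp: arcsine_moment_def Beta_def intro!: divide_pos_pos mult_pos_pos Gamma_real_pos)

lemma arcsine_moment_0_0: "arcsine_moment 0 0 = 1"
  by (simp add: arcsine_moment_def Beta_def Gamma_one_half_real)

text \<open>Apply \<open>Gamma (z + 1) = z * Gamma z\<close> to one factor on each side; the two
  Beta values share their denominator because their arguments have the same sum.\<close>

lemma arcsine_moment_rec:
  "(2 * real j + 1) * arcsine_moment (Suc i) j = (2 * real i + 1) * arcsine_moment i (Suc j)"
proof -
  have 1: "Gamma (real i + 1 / 2 + 1) = (real i + 1 / 2) * Gamma (real i + 1 / 2)" for i
    by (rule Gamma_plus1) (auto elim!: nonpos_Ints_cases')
  show ?thesis
    using 1[of i] 1[of j] by (simp add: arcsine_moment_def Beta_def add_ac divide_simps) algebra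
qed

lemma arcsine_moment_commute: "arcsine_moment i j = arcsine_moment j i"
  by (simp add: arcsine_moment_def Beta_commute)

lemma has_integral_arcsine_moment:
  "((\<lambda>u. u ^ i * (1 - u) ^ j * (1 / sqrt (u * (1 - u)))) has_integral pi * arcsine_moment i j) {0..1}"
proof -
  \<comment> \<open>At \<open>u = 0\<close> both sides are 0, by \<open>0 powr a = 0\<close> and
    \<open>1 / 0 = 0\<close>.\<close>
  have *: "u powr (real k - 1 / 2) = u ^ k * (1 / sqrt u)" if "u \<ge> 0" for u k
    using that by (cases "u = 0") (auto simp: powr_diff powr_realpow powr_half_sqrt)
  have "((\<lambda>u. u powr (real i + 1 / 2 - 1) * (1 - u) powr (real j + 1 / 2 - 1)) has_integral
      pi * arcsine_moment i j) {0..1}"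
    using has_integral_Beta_real[of "real i + 1 / 2" "real j + 1 / 2"]
    by (simp add: arcsine_moment_def)
  then show ?thesis
    by (rule has_integral_eq[rotated]) (use * in \<open>auto simp: real_sqrt_mult\<close>)
qed

section \<open>The rational solution in the variable \<open>c\<close>\<close>

text \<open>The coefficient of \<open>inverse (s ^ j)\<close> in the arcsine mean of
  \<open>((1 - u) / s + u) ^ m\<close>.\<close>

definition gcoeff :: "nat \<Rightarrow> nat \<Rightarrow> real" where
  "gcoeff m j = real (m choose j) * arcsine_moment j (m - j)"

definition Grat :: "nat \<Rightarrow> real \<Rightarrow> real" where
  "Grat m c = (\<Sum>j\<le>m. gcoeff m j * inverse (c ^ (2 * j + 1)))"

definition Grat' :: "nat \<Rightarrow> real \<Rightarrow> real" where
  "Grat' m c = (\<Sum>j\<le>m. - (2 * real j + 1) * gcoeff m j * inverse (c ^ (2 * j + 2)))"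

definition Grat'' :: "nat \<Rightarrow> real \<Rightarrow> real" where
  "Grat'' m c = (\<Sum>j\<le>m. (2 * real j + 1) * (2 * real j + 2) * gcoeff m j * inverse (c ^ (2 * j + 3)))"

lemma gcoeff_nonneg: "gcoeff m j \<ge> 0"
  by (simp add: gcoeff_def less_imp_le[OF arcsine_moment_pos])

text \<open>Absorption for binomial coefficients multiplied by \<open>arcsine_moment_rec\<close>.
  For \<open>j = m\<close> both sides vanish, since \<open>m choose Suc m = 0\<close> and
  \<open>m - j = 0\<close>.\<close>

lemma gcoeff_rec:
  assumes "j \<le> m"
  shows "real (Suc j) * (2 * real (m - j) - 1) * gcoeff m (Suc j)
    = (2 * real j + 1) * real (m - j) * gcoeff m j"
proof (cases "j = m")
  case False
  then obtain i where i: "m - j = Suc i" using assms by (metis Suc_diff_Suc le_neq_implies_less)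
  have b: "Suc j * (m choose Suc j) = Suc i * (m choose j)"
  proof -
    have "m = Suc (i + j)" using i assms by linarith
    then show ?thesis using binomial_absorption[of j m] binomial_absorb_comp[of m j] i by simp
  qed
  have i': "m - Suc j = i" using i by simp
  have "real (Suc j) * real (m choose Suc j) = real (Suc i) * real (m choose j)"
    using b by (metis of_nat_mult)
  moreover have "(2 * real i + 1) * arcsine_moment (Suc j) i = (2 * real j + 1) * arcsine_moment j (Suc i)"
    by (rule arcsine_moment_rec)
  ultimately have "(real (Suc j) * real (m choose Suc j)) * ((2 * real i + 1) * arcsine_moment (Suc j) i)
    = (real (Suc i) * real (m choose j)) * ((2 * real j + 1) * arcsine_moment j (Suc i))"
    by simp
  then show ?thesis by (simp only: gcoeff_def i i') (simp add: algebra_simps)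
qed (simp add: gcoeff_def)

lemma Grat_deriv:
  assumes "c \<noteq> 0"
  shows "(Grat m has_real_derivative Grat' m c) (at c)"
    and "(Grat' m has_real_derivative Grat'' m c) (at c)"
proof -
  note * = has_real_derivative_inverse_power[OF assms]
  show "(Grat m has_real_derivative Grat' m c) (at c)"
    unfolding Grat_def Grat'_def
  proof (intro DERIV_sum)
    fix j
    show "((\<lambda>c. gcoeff m j * inverse (c ^ (2 * j + 1))) has_real_derivative
       - (2 * real j + 1) * gcoeff m j * inverse (c ^ (2 * j + 2))) (at c)"
      using DERIV_cmult[OF *[of "2 * j + 1"], of "gcoeff m j"] by (simp add: algebra_simps)
  qed
  show "(Grat' m has_real_derivative Grat'' m c) (at c)"
    unfolding Grat'_def Grat''_def
  proof (intro DERIV_sum)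
    fix j
    show "((\<lambda>c. - (2 * real j + 1) * gcoeff m j * inverse (c ^ (2 * j + 2))) has_real_derivative
       (2 * real j + 1) * (2 * real j + 2) * gcoeff m j * inverse (c ^ (2 * j + 3))) (at c)"
      using DERIV_cmult[OF *[of "2 * j + 2"], of "- (2 * real j + 1) * gcoeff m j"]
      by (simp add: algebra_simps numeral_3_eq_3)
  qed
qed

text \<open>The equation of \<open>G (Suc m)\<close> takes this form under
  \<open>c = 1 + 2 * x\<close>, where \<open>4 * x * (1 + x) = c\<^sup>2 - 1\<close>. By
  \<open>gcoeff_rec\<close> each summand is a difference of consecutive values of one sequence, so
  the sum telescopes.\<close>

lemma Grat_ode:
  assumes "c \<noteq> 0"
  shows "c * (c\<^sup>2 - 1) * Grat'' m c + 2 * ((real m + 2) * (c\<^sup>2 - 1) + 1) * Grat' m c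
    + 2 * (real m + 1) * c * Grat m c = 0"
proof -
  \<comment> \<open>\<open>- b j\<close> collects the part of the \<open>j\<close>-th summand in
    \<open>inverse (c ^ (2 * j))\<close>; the recurrence turns the remaining part into
    \<open>b (Suc j)\<close>.\<close>
  define b where "b j = 2 * real j * (2 * real m - 2 * real j + 1) * gcoeff m j * inverse (c ^ (2 * j))" for j
  have "c * (c\<^sup>2 - 1) * Grat'' m c + 2 * ((real m + 2) * (c\<^sup>2 - 1) + 1) * Grat' m c
      + 2 * (real m + 1) * c * Grat m c
    = (\<Sum>j\<le>m. c * (c\<^sup>2 - 1) * ((2 * real j + 1) * (2 * real j + 2) * gcoeff m j * inverse (c ^ (2 * j + 3)))
        + 2 * ((real m + 2) * (c\<^sup>2 - 1) + 1) * (- (2 * real j + 1) * gcoeff m j * inverse (c ^ (2 * j + 2)))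
        + 2 * (real m + 1) * c * (gcoeff m j * inverse (c ^ (2 * j + 1))))"
    by (simp add: Grat_def Grat'_def Grat''_def sum.distrib sum_distrib_left)
  also have "\<dots> = (\<Sum>j\<le>m. b (Suc j) - b j)"
  proof (rule sum.cong)
    fix j assume "j \<in> {..m}"
    then have j: "j \<le> m" by simp
    define d where "d = inverse (c ^ (2 * j + 2))"
    have d: "inverse (c ^ (2 * j)) = c\<^sup>2 * d" "inverse (c ^ (2 * j + 1)) = c * d"
      "inverse (c ^ (2 * j + 3)) = d / c"
      using assms by (simp_all add: d_def field_simps power_add numeral_3_eq_3 power2_eq_square)
    have "b (Suc j) = 2 * (real (Suc j) * (2 * real (m - j) - 1) * gcoeff m (Suc j)) * d"
      using j by (simp add: b_def d_def of_nat_diff algebra_simps)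
    also have "\<dots> = 2 * ((2 * real j + 1) * real (m - j) * gcoeff m j) * d"
      by (simp only: gcoeff_rec[OF j])
    finally have b1: "b (Suc j) = 2 * (2 * real j + 1) * (real m - real j) * gcoeff m j * d"
      using j by (simp add: of_nat_diff)
    have b0: "b j = 2 * real j * (2 * real m - 2 * real j + 1) * gcoeff m j * (c\<^sup>2 * d)"
      by (simp add: b_def d)
    show "c * (c\<^sup>2 - 1) * ((2 * real j + 1) * (2 * real j + 2) * gcoeff m j * inverse (c ^ (2 * j + 3)))
        + 2 * ((real m + 2) * (c\<^sup>2 - 1) + 1) * (- (2 * real j + 1) * gcoeff m j * inverse (c ^ (2 * j + 2)))
        + 2 * (real m + 1) * c * (gcoeff m j * inverse (c ^ (2 * j + 1))) = b (Suc j) - b j"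
      unfolding b0 b1 d d_def[symmetric] using assms by (simp add: field_simps power2_eq_square)
  qed simp
  also have "\<dots> = (\<Sum>j<Suc m. b (Suc j) - b j)" by (simp add: lessThan_Suc_atMost)
  also have "\<dots> = b (Suc m) - b 0" by (rule sum_lessThan_telescope)
  \<comment> \<open>\<open>b 0\<close> has the factor \<open>j = 0\<close>, and
    \<open>gcoeff m (Suc m) = 0\<close>.\<close>
  also have "\<dots> = 0" by (simp add: b_def gcoeff_def)
  finally show ?thesis .
qed

section \<open>The integral representation\<close>

lemma has_integral_Grat:
  assumes "s \<noteq> 0"
  shows "((\<lambda>u. ((1 - u) / s + u) ^ m * (1 / sqrt (u * (1 - u)))) has_integral
     pi * (\<Sum>j\<le>m. gcoeff m j * inverse (s ^ j))) {0..1}"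
proof -
  have "((\<lambda>u. \<Sum>j\<le>m. (real (m choose j) * inverse (s ^ j)) * (u ^ (m - j) * (1 - u) ^ j * (1 / sqrt (u * (1 - u)))))
      has_integral (\<Sum>j\<le>m. (real (m choose j) * inverse (s ^ j)) * (pi * arcsine_moment (m - j) j))) {0..1}"
    by (intro has_integral_sum has_integral_mult_right has_integral_arcsine_moment) auto
  also have "(\<lambda>u. \<Sum>j\<le>m. (real (m choose j) * inverse (s ^ j)) * (u ^ (m - j) * (1 - u) ^ j * (1 / sqrt (u * (1 - u)))))
     = (\<lambda>u. ((1 - u) / s + u) ^ m * (1 / sqrt (u * (1 - u))))"
    unfolding binomial_ring sum_distrib_right
    by (intro ext sum.cong) (auto simp: power_mult_distrib power_inverse divide_inverse)
  also have "(\<Sum>j\<le>m. (real (m choose j) * inverse (s ^ j)) * (pi * arcsine_moment (m - j) j))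
     = pi * (\<Sum>j\<le>m. gcoeff m j * inverse (s ^ j))"
    unfolding arcsine_moment_commute[of "m - _"] by (simp add: gcoeff_def sum_distrib_left mult_ac)
  finally show ?thesis .
qed

text \<open>At \<open>s = 1\<close> the power in \<open>has_integral_Grat\<close> is 1, so only the
  total mass of the arcsine law remains. This is the initial value at \<open>x = 0\<close>.\<close>

lemma Grat_1: "Grat m 1 = 1"
proof -
  have "((\<lambda>u. 1 / sqrt (u * (1 - u))) has_integral pi * Grat m 1) {0..1}"
    using has_integral_Grat[of 1 m] by (simp add: Grat_def)
  moreover have "((\<lambda>u. 1 / sqrt (u * (1 - u))) has_integral pi) {0..1}"
    using has_integral_arcsine_moment[of 0 0] by (simp add: arcsine_moment_0_0)
  ultimately have "pi * Grat m 1 = pi" by (rule has_integral_unique)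
  then show ?thesis by simp
qed

lemma Grat_pos:
  assumes "c > 0"
  shows "Grat m c > 0"
proof -
  have "gcoeff m 0 > 0" by (simp add: gcoeff_def arcsine_moment_pos)
  then show ?thesis
    unfolding Grat_def using assms by (intro sum_pos2[of _ 0]) (auto simp: gcoeff_nonneg)
qed

lemma Grat''_nonneg: "c > 0 \<Longrightarrow> Grat'' m c \<ge> 0"
  unfolding Grat''_def by (intro sum_nonneg) (auto simp: gcoeff_nonneg)

text \<open>Under \<open>u = g t\<close> the arcsine weight reproduces itself up to the factor
  \<open>L t / c\<close>, and \<open>(1 - u) / s + u\<close> becomes \<open>1 / L t\<close>.
  Together with \<open>g' t = s / (L t)\<^sup>2\<close> this leaves \<open>m + 1\<close> inverse
  factors \<open>L t\<close>.\<close>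

lemma arcsine_integral_eq_Grat:
  assumes "c > 0"
  shows "(LBINT t:{0..1}. (t + (1 - t) * c\<^sup>2) powi (- int (Suc m)) * (1 / sqrt (t * (1 - t))))
    = pi * Grat m c"
proof -
  define s where "s = c\<^sup>2"
  have s: "s > 0" using assms by (simp add: s_def)
  define f where "f u = ((1 - u) / s + u) ^ m * (1 / sqrt (u * (1 - u)))" for u
  define L where "L t = t + (1 - t) * s" for t
  define g where "g t = t / L t" for t
  define g' where "g' t = s / (L t)\<^sup>2" for t
  have hf: "(f has_integral pi * (\<Sum>j\<le>m. gcoeff m j * inverse (s ^ j))) {0..1}"
    unfolding f_def using has_integral_Grat[of s m] s by simp
  have f_nonneg: "f u \<ge> 0" if "u \<in> {0..1}" for u
    unfolding f_def using that s by auto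
  \<comment> \<open>Nonnegativity upgrades the gauge integral to absolute integrability, as the
    substitution rule for Lebesgue integrals demands.\<close>
  have "f absolutely_integrable_on {0..1}"
    using hf f_nonneg by (intro nonnegative_absolutely_integrable_1) auto
  then have intf: "set_integrable lborel {0..1} f"
    unfolding set_integrable_def by (subst (asm) integrable_completion) (auto simp: f_def)
  have L: "L t > 0" if "t \<in> {0..1}" for t
  proof (cases "t = 0")
    case False
    then have "t > 0" "(1 - t) * s \<ge> 0" using that s by auto
    then show ?thesis by (simp add: L_def)
  qed (simp add: L_def s)
  have g01: "g 0 = 0" "g 1 = 1" by (simp_all add: g_def L_def)
  have dg: "(g has_real_derivative g' t) (at t)" if "t \<in> {0..1}" for t
    unfolding g_def[abs_def] g'_def L_def using L[OF that] that unfolding L_def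
    by (auto intro!: derivative_eq_intros simp: field_simps power2_eq_square)
  have cg: "continuous_on {0..1} g'"
    unfolding g'_def using L by (auto intro!: continuous_intros simp: L_def less_imp_neq[THEN not_sym])
  have "(LBINT u. f u * indicator {g 0..g 1} u) = (LBINT t. f (g t) * g' t * indicator {0..1} t)"
    by (rule integral_substitution(2)) (use intf dg cg s in \<open>auto simp: g01 g'_def\<close>)
  then have sub: "(LBINT u:{0..1}. f u) = (LBINT t:{0..1}. f (g t) * g' t)"
    by (simp add: g01 set_lebesgue_integral_def mult_ac)
  have "(LBINT t:{0..1}. (t + (1 - t) * c\<^sup>2) powi (- int (Suc m)) * (1 / sqrt (t * (1 - t))))
    = (LBINT t:{0..1}. (1 / c) * (f (g t) * g' t))"
  proof (rule set_lebesgue_integral_cong; safe?)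
    \<comment> \<open>The endpoints are included: there \<open>1 / sqrt 0 = 0\<close> makes both
      integrands 0.\<close>
    fix t :: real assume t: "t \<in> {0..1}"
    have Lt: "L t > 0" using L t by blast
    have 1: "1 - g t = s * (1 - t) / L t"
      using Lt by (simp add: g_def L_def field_simps)
    have 2: "(1 - g t) / s + g t = 1 / L t"
      using Lt s unfolding 1 by (simp add: g_def field_simps)
    have 3: "g t * (1 - g t) = (c / L t)\<^sup>2 * (t * (1 - t))"
      unfolding 1 by (simp add: g_def s_def power2_eq_square)
    have 4: "sqrt (g t * (1 - g t)) = (c / L t) * sqrt (t * (1 - t))"
      unfolding 3 real_sqrt_mult using assms Lt by simp
    have "f (g t) * g' t = (1 / L t) ^ m * (1 / ((c / L t) * sqrt (t * (1 - t)))) * (s / (L t)\<^sup>2)"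
      by (simp only: f_def 2 4 g'_def)
    also have "\<dots> = c * (inverse (L t ^ Suc m) * (1 / sqrt (t * (1 - t))))"
      using assms Lt by (simp add: s_def power2_eq_square power_divide field_simps)
    finally show "(t + (1 - t) * c\<^sup>2) powi (- int (Suc m)) * (1 / sqrt (t * (1 - t))) = (1 / c) * (f (g t) * g' t)"
      using assms by (simp only: power_int_minus power_int_of_nat s_def[symmetric] L_def[symmetric]) simp
  qed auto
  also have "\<dots> = (1 / c) * (LBINT u:{0..1}. f u)"
    unfolding sub by simp
  also have "(LBINT u:{0..1}. f u) = pi * (\<Sum>j\<le>m. gcoeff m j * inverse (s ^ j))"
    using set_borel_integral_eq_integral(2)[OF intf] hf by (simp add: integral_unique)
  also have "(1 / c) * \<dots> = pi * Grat m c"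
    by (simp add: Grat_def s_def power_mult[symmetric] sum_distrib_left divide_inverse mult_ac)
  finally show ?thesis .
qed

section \<open>The hypergeometric series and the differential equation of \<open>G\<close>\<close>

text \<open>The square of \<open>(n)_k / k!\<close>, hence the coefficient of \<open>w ^ k\<close>
  in \<open>2F1(n, n; 1; w)\<close>.\<close>

definition hyp_coeff :: "nat \<Rightarrow> nat \<Rightarrow> real" where
  "hyp_coeff n k = (real ((n + k - 1) choose k))\<^sup>2"

lemma hyp_coeff_rec:
  assumes "n \<ge> 1"
  shows "(real k + 1)\<^sup>2 * hyp_coeff n (Suc k) = (real n + real k)\<^sup>2 * hyp_coeff n k"
proof -
  obtain m where n: "n = Suc m" using assms by (cases n) auto
  have "Suc k * (Suc (m + k) choose Suc k) = Suc (m + k) * (m + k choose k)"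
    using Suc_times_binomial[of k "m + k"] by simp
  then have "(real k + 1) * real (Suc (m + k) choose Suc k) = (real n + real k) * real (m + k choose k)"
    unfolding n by (metis of_nat_Suc of_nat_add of_nat_mult add_Suc add.commute plus_1_eq_Suc)
  then have "((real k + 1) * real (Suc (m + k) choose Suc k))\<^sup>2 = ((real n + real k) * real (m + k choose k))\<^sup>2"
    by simp
  then show ?thesis by (simp add: hyp_coeff_def n power_mult_distrib)
qed

lemma G_term_eq:
  assumes "x \<ge> 0"
  shows "(real ((n + k - 1) choose k) * x ^ k * (1 + x) powi (- int n - int k))\<^sup>2
    = inverse ((1 + x) ^ (2 * n)) * (hyp_coeff n k * ((x / (1 + x))\<^sup>2) ^ k)"
proof -
  have "- int n - int k = - int (n + k)" by simp
  then have p: "(1 + x) powi (- int n - int k) = inverse ((1 + x) ^ (n + k))"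
    by (simp only: power_int_minus power_int_of_nat)
  have "((1 + x) ^ n)\<^sup>2 = (1 + x) ^ (2 * n)" "((1 + x) ^ k)\<^sup>2 = ((1 + x)\<^sup>2) ^ k" "(x ^ k)\<^sup>2 = (x\<^sup>2) ^ k"
    by (simp_all add: power_mult[symmetric] mult.commute)
  then show ?thesis
    unfolding p by (simp add: hyp_coeff_def power_mult_distrib power_divide power_add field_simps)
qed

lemma hyp_summable:
  assumes "n \<ge> 1" "norm z < 1"
  shows "summable (\<lambda>k. hyp_coeff n k * z ^ k)"
proof -
  define r where "r = sqrt \<bar>z\<bar>"
  have r: "0 \<le> r" "r < 1" "r\<^sup>2 = \<bar>z\<bar>" using assms by (auto simp: r_def)
  \<comment> \<open>Solves \<open>x / (1 + x) = r\<close>; the series of \<open>G n\<close> at this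
    \<open>x\<close> is a nonzero multiple of the series at \<open>\<bar>z\<bar>\<close>.\<close>
  define x where "x = r / (1 - r)"
  have x: "x \<ge> 0" using r by (simp add: x_def)
  have xr: "x / (1 + x) = r" using r by (simp add: x_def field_simps)
  have "summable (\<lambda>k. inverse ((1 + x) ^ (2 * n)) * (hyp_coeff n k * \<bar>z\<bar> ^ k))"
    using G_summable[OF assms(1) x] unfolding G_term_eq[OF x] xr r .
  then have "summable (\<lambda>k. hyp_coeff n k * \<bar>z\<bar> ^ k)"
    using x by (subst (asm) summable_cmult_iff) auto
  then show ?thesis
    by (rule summable_comparison_test[rotated]) (auto simp: abs_mult power_abs hyp_coeff_def)
qed

definition hyp :: "nat \<Rightarrow> real \<Rightarrow> real" where "hyp n w = (\<Sum>k. hyp_coeff n k * w ^ k)"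
definition hyp' :: "nat \<Rightarrow> real \<Rightarrow> real" where "hyp' n w = (\<Sum>k. diffs (hyp_coeff n) k * w ^ k)"
definition hyp'' :: "nat \<Rightarrow> real \<Rightarrow> real" where "hyp'' n w = (\<Sum>k. diffs (diffs (hyp_coeff n)) k * w ^ k)"

lemma hyp_derivs:
  assumes "n \<ge> 1" "norm w < 1"
  shows "(hyp n has_real_derivative hyp' n w) (at w)"
    and "(hyp' n has_real_derivative hyp'' n w) (at w)"
proof -
  show "(hyp n has_real_derivative hyp' n w) (at w)"
    unfolding hyp_def[abs_def] hyp'_def
    by (rule termdiffs_strong'[of 1]) (use assms hyp_summable in auto)
  show "(hyp' n has_real_derivative hyp'' n w) (at w)"
    unfolding hyp'_def[abs_def] hyp''_def
    by (rule termdiffs_strong'[of 1]) (use assms hyp_summable in \<open>auto intro: termdiff_converges[of _ 1]\<close>)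
qed

text \<open>On the left the coefficient of \<open>w ^ k\<close> is
  \<open>(k + 1)\<^sup>2 * h (k + 1) - (n + k)\<^sup>2 * h k\<close> with
  \<open>h = hyp_coeff n\<close>, which vanishes by \<open>hyp_coeff_rec\<close>.\<close>

lemma hyp_ode:
  assumes n: "n \<ge> 1" and w: "norm w < 1"
  shows "w * (1 - w) * hyp'' n w + (1 - (2 * real n + 1) * w) * hyp' n w - (real n)\<^sup>2 * hyp n w = 0"
proof -
  let ?h = "hyp_coeff n"
  have s1: "summable (\<lambda>k. diffs ?h k * z ^ k)" if "norm z < 1" for z
    using that by (intro termdiff_converges[of _ 1]) (use n hyp_summable in auto)
  have s2: "summable (\<lambda>k. diffs (diffs ?h) k * w ^ k)"
    by (rule termdiff_converges[OF w]) (rule s1)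
  have a0: "(\<lambda>k. ?h k * w ^ k) sums hyp n w"
    unfolding hyp_def by (rule summable_sums[OF hyp_summable[OF n w]])
  have a1: "(\<lambda>k. (real k + 1) * ?h (Suc k) * w ^ k) sums hyp' n w"
    using summable_sums[OF s1[OF w]] by (simp add: hyp'_def diffs_def add_ac)
  have a2: "(\<lambda>k. (real k + 1) * (real k + 2) * ?h (Suc (Suc k)) * w ^ k) sums hyp'' n w"
    using summable_sums[OF s2] by (simp add: hyp''_def diffs_def add_ac mult_ac)
  \<comment> \<open>Multiplication by \<open>w\<close> shifts the index by one; the new term at
    \<open>k = 0\<close> vanishes through its factor \<open>real k\<close>.\<close>
  have b1: "(\<lambda>k. real k * ?h k * w ^ k) sums (w * hyp' n w)"
    by (rule sums_Suc_imp) (use sums_mult[OF a1, of w] in \<open>simp_all add: algebra_simps\<close>)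
  have b2: "(\<lambda>k. real k * (real k + 1) * ?h (Suc k) * w ^ k) sums (w * hyp'' n w)"
    by (rule sums_Suc_imp) (use sums_mult[OF a2, of w] in \<open>simp_all add: algebra_simps\<close>)
  have c2: "(\<lambda>k. (real k - 1) * real k * ?h k * w ^ k) sums (w * (w * hyp'' n w))"
    by (rule sums_Suc_imp) (use sums_mult[OF b2, of w] in \<open>simp_all add: algebra_simps\<close>)
  have "(\<lambda>k. ((real k * (real k + 1) * ?h (Suc k) * w ^ k - (real k - 1) * real k * ?h k * w ^ k)
        + ((real k + 1) * ?h (Suc k) * w ^ k - (2 * real n + 1) * (real k * ?h k * w ^ k)))
        - (real n)\<^sup>2 * (?h k * w ^ k)) sums
      (((w * hyp'' n w - w * (w * hyp'' n w)) + (hyp' n w - (2 * real n + 1) * (w * hyp' n w)))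
        - (real n)\<^sup>2 * hyp n w)"
    by (intro sums_add sums_diff sums_mult a0 a1 b1 b2 c2)
  moreover have "((real k * (real k + 1) * ?h (Suc k) * w ^ k - (real k - 1) * real k * ?h k * w ^ k)
        + ((real k + 1) * ?h (Suc k) * w ^ k - (2 * real n + 1) * (real k * ?h k * w ^ k)))
        - (real n)\<^sup>2 * (?h k * w ^ k) = 0" for k
  proof -
    have "((real k * (real k + 1) * ?h (Suc k) * w ^ k - (real k - 1) * real k * ?h k * w ^ k)
        + ((real k + 1) * ?h (Suc k) * w ^ k - (2 * real n + 1) * (real k * ?h k * w ^ k)))
        - (real n)\<^sup>2 * (?h k * w ^ k)
       = ((real k + 1)\<^sup>2 * ?h (Suc k) - (real n + real k)\<^sup>2 * ?h k) * w ^ k"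
      by (simp add: algebra_simps power2_eq_square)
    then show ?thesis using hyp_coeff_rec[OF n, of k] by simp
  qed
  ultimately have "(\<lambda>k. 0 :: real) sums
      (((w * hyp'' n w - w * (w * hyp'' n w)) + (hyp' n w - (2 * real n + 1) * (w * hyp' n w)))
        - (real n)\<^sup>2 * hyp n w)" by simp
  from sums_unique2[OF this sums_zero] show ?thesis by (simp add: algebra_simps)
qed

lemma G_eq_hyp:
  assumes "n \<ge> 1" "x \<ge> 0"
  shows "G n x = inverse ((1 + x) ^ (2 * n)) * hyp n ((x / (1 + x))\<^sup>2)"
proof -
  have "norm ((x / (1 + x))\<^sup>2) < 1"
    using assms by (simp add: power_divide power_strict_mono)
  then show ?thesis
    unfolding G_def hyp_def G_term_eq[OF assms(2)] by (intro suminf_mult hyp_summable assms(1))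
qed

text \<open>Formulated for an arbitrary function, so that one uniqueness argument can compare
  \<open>G n\<close> with the rational solution.\<close>

definition G_ode_on_nonneg :: "nat \<Rightarrow> (real \<Rightarrow> real) \<Rightarrow> (real \<Rightarrow> real) \<Rightarrow> (real \<Rightarrow> real) \<Rightarrow> bool" where
  "G_ode_on_nonneg n y y' y'' \<longleftrightarrow> has_two_derivs_on {0..} y y' y'' \<and>
     (\<forall>x\<ge>0. x * (1 + x) * (1 + 2 * x) * y'' x
              + (4 * (real n + 1) * x * (1 + x) + 1) * y' x
              + 2 * real n * (1 + 2 * x) * y x = 0)"

lemma G_ode:
  assumes n: "n \<ge> 1"
  shows "\<exists>G' G''. G_ode_on_nonneg n (G n) G' G''"
proof -
  define w where "w x = (x / (1 + x))\<^sup>2" for x :: real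
  define w1 where "w1 x = 2 * x / (1 + x) ^ 3" for x :: real
  define w2 where "w2 x = (2 - 4 * x) / (1 + x) ^ 4" for x :: real
  define K where "K x = inverse ((1 + x) ^ (2 * n))" for x :: real
  define K1 where "K1 x = - 2 * real n * K x / (1 + x)" for x :: real
  define K2 where "K2 x = 2 * real n * (2 * real n + 1) * K x / (1 + x)\<^sup>2" for x :: real
  define F where "F x = K x * hyp n (w x)" for x
  define F1 where "F1 x = K1 x * hyp n (w x) + K x * (w1 x * hyp' n (w x))" for x
  define F2 where "F2 x = K2 x * hyp n (w x) + 2 * K1 x * (w1 x * hyp' n (w x))
     + K x * (w2 x * hyp' n (w x) + w1 x * (w1 x * hyp'' n (w x)))" for x
  have w_less: "norm (w x) < 1" if "x \<ge> 0" for x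
    using that by (simp add: w_def power_divide power_strict_mono)
  have dw: "(w has_real_derivative w1 x) (at x)" if "x \<ge> 0" for x
    unfolding w_def[abs_def] w1_def using that
    by (auto intro!: derivative_eq_intros simp: divide_simps) (simp add: algebra_simps eval_nat_numeral)
  have dw1: "(w1 has_real_derivative w2 x) (at x)" if "x \<ge> 0" for x
    unfolding w1_def[abs_def] w2_def using that
    by (auto intro!: derivative_eq_intros simp: divide_simps) (simp add: algebra_simps eval_nat_numeral)
  have dK: "(K has_real_derivative K1 x) (at x)" if "x \<ge> 0" for x
  proof -
    have "((\<lambda>x. 1 + x) has_real_derivative 1) (at x)"
      by (auto intro!: derivative_eq_intros)
    from DERIV_chain2[OF has_real_derivative_inverse_power[of "1 + x" "2 * n"] this] that
    show ?thesis by (simp add: K_def[abs_def] K1_def divide_inverse mult_ac)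
  qed
  have dK1: "(K1 has_real_derivative K2 x) (at x)" if "x \<ge> 0" for x
  proof -
    have "((\<lambda>x. - 2 * real n * K x / (1 + x)) has_real_derivative
      ((- 2 * real n * K1 x) * (1 + x) - (- 2 * real n * K x)) / ((1 + x) * (1 + x))) (at x)"
    proof (rule DERIV_divide[THEN DERIV_cong])
      show "((\<lambda>x. - 2 * real n * K x) has_real_derivative - 2 * real n * K1 x) (at x)"
        by (intro DERIV_cmult dK that)
      show "((\<lambda>x. 1 + x) has_real_derivative 1) (at x)"
        by (auto intro!: derivative_eq_intros)
    qed (use that in auto)
    also have "((- 2 * real n * K1 x) * (1 + x) - (- 2 * real n * K x)) / ((1 + x) * (1 + x)) = K2 x"
    proof -
      have "((- a * (- a * k / v)) * v - (- a * k)) / (v * v) = a * (a + 1) * k / v\<^sup>2"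
        if "v \<noteq> 0" for a k v :: real
        using that by (simp add: power2_eq_square algebra_simps)
      from this[of "1 + x" "2 * real n" "K x"] that show ?thesis by (simp add: K1_def K2_def)
    qed
    finally show ?thesis by (simp add: K1_def[abs_def])
  qed
  have dh: "((\<lambda>x. hyp n (w x)) has_real_derivative w1 x * hyp' n (w x)) (at x)" if "x \<ge> 0" for x
    using DERIV_chain2[OF hyp_derivs(1)[OF n w_less[OF that]] dw[OF that]] by (simp add: mult.commute)
  have dh': "((\<lambda>x. hyp' n (w x)) has_real_derivative w1 x * hyp'' n (w x)) (at x)" if "x \<ge> 0" for x
    using DERIV_chain2[OF hyp_derivs(2)[OF n w_less[OF that]] dw[OF that]] by (simp add: mult.commute)
  have dF: "(F has_real_derivative F1 x) (at x)" if "x \<ge> 0" for x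
    unfolding F_def[abs_def] F1_def
    by (rule derivative_eq_intros dK dh that)+ simp
  have dF1: "(F1 has_real_derivative F2 x) (at x)" if "x \<ge> 0" for x
    unfolding F1_def[abs_def] F2_def
    by (rule DERIV_cong[OF DERIV_add[OF DERIV_mult[OF dK1 dh] DERIV_mult[OF dK DERIV_mult[OF dw1 dh']]]])
      (simp_all add: that algebra_simps)
  have ode: "x * (1 + x) * (1 + 2 * x) * F2 x + (4 * (real n + 1) * x * (1 + x) + 1) * F1 x
       + 2 * real n * (1 + 2 * x) * F x = 0" if x: "x \<ge> 0" for x
  proof -
    define v where "v = 1 + x"
    have v: "v > 0" "x = v - 1" using x by (auto simp: v_def)
    let ?p = "x * v * (1 + 2 * x)" and ?q = "4 * (real n + 1) * x * v + 1" and ?N = "real n"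
    have wv: "w x = x\<^sup>2 / v\<^sup>2" by (simp add: w_def v_def power_divide)
    \<comment> \<open>\<open>A\<close>, \<open>B\<close> and \<open>C\<close> are the coefficients
      of \<open>hyp\<close>, \<open>hyp'\<close> and \<open>hyp''\<close> after inserting the
      derivatives and dividing by \<open>K x\<close>; each is \<open>4 * x / v\<close> times its
      counterpart in \<open>hyp_ode\<close>.\<close>
    have A: "?p * (2 * ?N * (2 * ?N + 1) / v\<^sup>2) + ?q * (- 2 * ?N / v) + 2 * ?N * (1 + 2 * x)
      = - (4 * x / v) * ?N\<^sup>2"
      using v(1) by (simp add: divide_simps) (simp add: v(2) algebra_simps power2_eq_square)
    have B: "?p * (2 * (- 2 * ?N / v) * (2 * x / v ^ 3) + (2 - 4 * x) / v ^ 4) + ?q * (2 * x / v ^ 3)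
      = (4 * x / v) * (1 - (2 * ?N + 1) * (x\<^sup>2 / v\<^sup>2))"
      using v(1) by (simp add: divide_simps) (simp add: v(2) algebra_simps eval_nat_numeral)
    have C: "?p * ((2 * x / v ^ 3) * (2 * x / v ^ 3)) = (4 * x / v) * (x\<^sup>2 / v\<^sup>2 * (1 - x\<^sup>2 / v\<^sup>2))"
      using v(1) by (simp add: divide_simps) (simp add: v(2) algebra_simps eval_nat_numeral)
    have "x * (1 + x) * (1 + 2 * x) * F2 x + (4 * (real n + 1) * x * (1 + x) + 1) * F1 x
         + 2 * real n * (1 + 2 * x) * F x
      = K x * ((?p * (2 * ?N * (2 * ?N + 1) / v\<^sup>2) + ?q * (- 2 * ?N / v) + 2 * ?N * (1 + 2 * x)) * hyp n (w x)
         + (?p * (2 * (- 2 * ?N / v) * (2 * x / v ^ 3) + (2 - 4 * x) / v ^ 4) + ?q * (2 * x / v ^ 3)) * hyp' n (w x)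
         + (?p * ((2 * x / v ^ 3) * (2 * x / v ^ 3))) * hyp'' n (w x))"
      unfolding F_def F1_def F2_def K1_def K2_def w1_def w2_def v_def[symmetric]
      by (simp add: algebra_simps)
    also have "\<dots> = K x * (4 * x / v) * (w x * (1 - w x) * hyp'' n (w x)
        + (1 - (2 * ?N + 1) * w x) * hyp' n (w x) - ?N\<^sup>2 * hyp n (w x))"
    proof -
      have "k * (- a * N * h + a * b * h1 + a * c * h2) = k * a * (c * h2 + b * h1 - N * h)"
        for k a b c N h h1 h2 :: real
        by (simp add: algebra_simps)
      then show ?thesis unfolding A B C wv[symmetric] by blast
    qed
    also have "\<dots> = 0" using hyp_ode[OF n w_less[OF x]] by simp
    finally show ?thesis .
  qed
  have GF: "G n x = F x" if "x \<ge> 0" for x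
    using G_eq_hyp[OF n that] by (simp add: F_def K_def w_def)
  have "has_two_derivs_on {0..} (G n) F1 F2"
    unfolding has_two_derivs_on_def
  proof (intro ballI conjI)
    fix x :: real assume x: "x \<in> {0..}"
    \<comment> \<open>\<open>F\<close> is differentiable from both sides even at 0 but is known to
      equal \<open>G n\<close> only for \<open>x \<ge> 0\<close>, so its derivative is restricted
      before the transfer.\<close>
    have "(F has_real_derivative F1 x) (at x within {0..})"
      using dF x by (auto intro: has_field_derivative_at_within)
    then show "(G n has_real_derivative F1 x) (at x within {0..})"
      by (rule has_field_derivative_transform_within[of _ _ _ _ 1]) (use x GF in auto)
    show "(F1 has_real_derivative F2 x) (at x within {0..})"
      using dF1 x by (auto intro: has_field_derivative_at_within)
  qed
  then have "G_ode_on_nonneg n (G n) F1 F2"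
    unfolding G_ode_on_nonneg_def using ode GF by auto
  then show ?thesis by blast
qed

section \<open>Uniqueness at the singular point and the closed form of \<open>G\<close>\<close>

text \<open>The factor \<open>x\<close> makes \<open>V\<close> vanish at 0 without any condition on
  the derivatives, so agreement of the values at 0 suffices. The Wronskian is the numerator of the
  derivative of \<open>z / y\<close>, and positivity of \<open>y\<close> permits the
  division.\<close>

lemma G_ode_unique:
  assumes n: "n \<ge> 1"
    and y: "G_ode_on_nonneg n y y' y''" and z: "G_ode_on_nonneg n z z' z''"
    and pos: "\<And>x. x \<ge> 0 \<Longrightarrow> y x > 0" and init: "y 0 = z 0" and x: "x \<ge> 0"
  shows "z x = y x"
proof -
  define W where "W x = y x * z' x - z x * y' x" for x
  define V where "V x = x * (1 + x) * (1 + 2 * x) ^ (2 * n) * W x" for x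
  have dy: "(y has_real_derivative y' x) (at x within {0..})" "(y' has_real_derivative y'' x) (at x within {0..})"
    if "x \<ge> 0" for x using y that by (auto simp: G_ode_on_nonneg_def has_two_derivs_on_def)
  have dz: "(z has_real_derivative z' x) (at x within {0..})" "(z' has_real_derivative z'' x) (at x within {0..})"
    if "x \<ge> 0" for x using z that by (auto simp: G_ode_on_nonneg_def has_two_derivs_on_def)
  have oy: "x * (1 + x) * (1 + 2 * x) * y'' x + (4 * (real n + 1) * x * (1 + x) + 1) * y' x
              + 2 * real n * (1 + 2 * x) * y x = 0" if "x \<ge> 0" for x
    using y that by (simp add: G_ode_on_nonneg_def)
  have oz: "x * (1 + x) * (1 + 2 * x) * z'' x + (4 * (real n + 1) * x * (1 + x) + 1) * z' x
              + 2 * real n * (1 + 2 * x) * z x = 0" if "x \<ge> 0" for x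
    using z that by (simp add: G_ode_on_nonneg_def)
  have dW: "(W has_real_derivative y x * z'' x - z x * y'' x) (at x within {0..})" if "x \<ge> 0" for x
    unfolding W_def[abs_def]
    by (rule DERIV_cong[OF DERIV_diff[OF DERIV_mult[OF dy(1) dz(2)] DERIV_mult[OF dz(1) dy(2)]]])
      (simp_all add: that algebra_simps)
  obtain m where m: "2 * n = Suc m" using n by (cases "2 * n") auto
  have m': "2 * real n = real m + 1" using m by linarith
  have dV: "(V has_real_derivative 0) (at x within {0..})" if x: "x \<ge> 0" for x
  proof -
    let ?D = "y x * z'' x - z x * y'' x" and ?p = "x * (1 + x) * (1 + 2 * x)"
      and ?q = "4 * (real n + 1) * x * (1 + x) + 1"
    have qm: "?q = 2 * (real m + 3) * x * (1 + x) + 1" using m' by algebra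
    have "(V has_real_derivative (1 + 2 * x) ^ m * (?q * W x + ?p * ?D)) (at x within {0..})"
      unfolding V_def[abs_def] m qm
      by (rule derivative_eq_intros dW x refl)+ (simp add: algebra_simps power2_eq_square)
    \<comment> \<open>Lagrange's identity: \<open>y\<close> times the equation of \<open>z\<close>
      minus \<open>z\<close> times that of \<open>y\<close>; the zeroth-order terms cancel.\<close>
    moreover have "?q * W x + ?p * ?D
       = y x * (?p * z'' x + ?q * z' x + 2 * real n * (1 + 2 * x) * z x)
        - z x * (?p * y'' x + ?q * y' x + 2 * real n * (1 + 2 * x) * y x)"
      unfolding W_def by (simp add: algebra_simps)
    ultimately show ?thesis using oy[OF x] oz[OF x] by simp
  qed
  obtain c where c: "\<And>x. x \<ge> 0 \<Longrightarrow> V x = c"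
    using has_field_derivative_zero_constant[of "{0..}" V] dV by (auto simp: convex_real_interval)
  have "V 0 = 0" by (simp add: V_def)
  then have V0: "V x = 0" if "x \<ge> 0" for x using c[OF that] c[of 0] by simp
  have W0: "W x = 0" if "x \<ge> 0" for x
  proof (cases "x = 0")
    case True
    \<comment> \<open>At 0 the vanishing of \<open>V\<close> says nothing about \<open>W\<close>,
      but the leading coefficient of the differential equation vanishes too and leaves a first-order
      relation.\<close>
    have "y' 0 = - 2 * real n * y 0" "z' 0 = - 2 * real n * z 0" using oy[of 0] oz[of 0] by auto
    then show ?thesis using True by (simp add: W_def)
  next
    case False
    then show ?thesis using V0[OF that] that by (simp add: V_def)
  qed
  have "((\<lambda>x. z x / y x) has_real_derivative 0) (at x within {0..})" if x: "x \<ge> 0" for x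
  proof -
    have "((\<lambda>x. z x / y x) has_real_derivative (z' x * y x - z x * y' x) / (y x * y x)) (at x within {0..})"
      using pos[OF x] by (intro DERIV_divide dy dz x) auto
    then show ?thesis using W0[OF x] by (simp add: W_def mult.commute)
  qed
  then obtain d where d: "\<And>x. x \<ge> 0 \<Longrightarrow> z x / y x = d"
    using has_field_derivative_zero_constant[of "{0..}" "\<lambda>x. z x / y x"] by (auto simp: convex_real_interval)
  have "z x / y x = 1" using d[OF x] d[of 0] pos[of 0] init by simp
  then show ?thesis using pos[OF x] by simp
qed

lemma Grat_ode_on_nonneg:
  "G_ode_on_nonneg (Suc m) (\<lambda>x. Grat m (1 + 2 * x)) (\<lambda>x. 2 * Grat' m (1 + 2 * x))
     (\<lambda>x. 4 * Grat'' m (1 + 2 * x))"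
proof -
  have lin: "((\<lambda>x. 1 + 2 * x) has_real_derivative 2) (at x within {0..})" for x :: real
    by (auto intro!: derivative_eq_intros)
  have "has_two_derivs_on {0..} (\<lambda>x. Grat m (1 + 2 * x)) (\<lambda>x. 2 * Grat' m (1 + 2 * x))
     (\<lambda>x. 4 * Grat'' m (1 + 2 * x))"
    unfolding has_two_derivs_on_def
  proof (intro ballI conjI)
    fix x :: real assume "x \<in> {0..}"
    then have c: "1 + 2 * x \<noteq> 0" by auto
    show "((\<lambda>x. Grat m (1 + 2 * x)) has_real_derivative 2 * Grat' m (1 + 2 * x)) (at x within {0..})"
      using DERIV_chain2[OF Grat_deriv(1)[OF c] lin] by (simp add: mult.commute)
    show "((\<lambda>x. 2 * Grat' m (1 + 2 * x)) has_real_derivative 4 * Grat'' m (1 + 2 * x)) (at x within {0..})"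
      using DERIV_cmult[OF DERIV_chain2[OF Grat_deriv(2)[OF c] lin], of 2] by (simp add: mult.commute)
  qed
  moreover have "x * (1 + x) * (1 + 2 * x) * (4 * Grat'' m (1 + 2 * x))
      + (4 * (real (Suc m) + 1) * x * (1 + x) + 1) * (2 * Grat' m (1 + 2 * x))
      + 2 * real (Suc m) * (1 + 2 * x) * Grat m (1 + 2 * x) = 0" if "x \<ge> 0" for x
  proof -
    have c: "1 + 2 * x \<noteq> 0" using that by auto
    show ?thesis using Grat_ode[OF c, of m] by (simp add: algebra_simps power2_eq_square)
  qed
  ultimately show ?thesis by (simp add: G_ode_on_nonneg_def)
qed

lemma G_eq_Grat:
  assumes "x \<ge> 0"
  shows "G (Suc m) x = Grat m (1 + 2 * x)"
proof -
  obtain G' G'' where ode: "G_ode_on_nonneg (Suc m) (G (Suc m)) G' G''"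
    using G_ode[of "Suc m"] by auto
  have "G (Suc m) 0 = 1"
    by (simp add: G_eq_hyp hyp_def hyp_coeff_def)
  \<comment> \<open>\<open>Grat\<close> takes the role of \<open>y\<close>, because its positivity
    is visible from its coefficients.\<close>
  then show ?thesis
    using assms Grat_1[of m] by (intro G_ode_unique[OF _ Grat_ode_on_nonneg ode]) (auto intro!: Grat_pos)
qed

section \<open>The upper bound\<close>

text \<open>Because \<open>Grat\<close> is convex, dropping the second-order term of the differential equation leaves
  a differential inequality for \<open>ln \<circ> G\<close> which integrates to exactly the stated bound.\<close>

lemma Grat_bound:
  assumes "x \<ge> 0"
  shows "Grat m (1 + 2 * x) \<le>
    (4 * (real m + 2) * x * (1 + x) + 1) powr (- (real (Suc m) / (2 * (real m + 2))))"
proof -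
  define P where "P x = 4 * (real m + 2) * x * (1 + x) + 1" for x
  define r where "r = real (Suc m) / (2 * (real m + 2))"
  \<comment> \<open>The logarithm of the quotient of \<open>Grat\<close> by the claimed bound; it is
    0 at \<open>x = 0\<close>, so it suffices that it never increases.\<close>
  define \<phi> where "\<phi> x = ln (Grat m (1 + 2 * x)) + r * ln (P x)" for x
  have P: "P x > 0" if "x \<ge> 0" for x unfolding P_def using that by (intro add_nonneg_pos) auto
  have g: "Grat m (1 + 2 * x) > 0" if "x \<ge> 0" for x using that by (intro Grat_pos) auto
  have "\<phi> 0 \<ge> \<phi> x"
  proof (rule DERIV_nonpos_imp_nonincreasing[OF assms])
    fix t :: real assume "0 \<le> t" "t \<le> x"
    then have t: "t \<ge> 0" and c: "1 + 2 * t \<noteq> 0" by auto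
    let ?y = "Grat m (1 + 2 * t)" and ?y' = "2 * Grat' m (1 + 2 * t)"
    have "((\<lambda>x. Grat m (1 + 2 * x)) has_real_derivative ?y') (at t)"
      by (rule DERIV_cong[OF DERIV_chain2[where f = "Grat m" and g = "\<lambda>x. 1 + 2 * x", OF Grat_deriv(1)[OF c]]])
        (auto intro!: derivative_eq_intros)
    moreover have "(P has_real_derivative 4 * (real m + 2) * (1 + 2 * t)) (at t)"
      unfolding P_def[abs_def] by (auto intro!: derivative_eq_intros simp: algebra_simps)
    ultimately have "(\<phi> has_real_derivative ?y' / ?y + r * (4 * (real m + 2) * (1 + 2 * t) / P t)) (at t)"
      unfolding \<phi>_def[abs_def] using P[OF t] g[OF t] by (auto intro!: derivative_eq_intros)
    \<comment> \<open>The exponent satisfies \<open>r * (m + 2) = (m + 1) / 2\<close>, which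
      produces exactly the zeroth-order coefficient of the differential equation.\<close>
    also have "r * (4 * (real m + 2) * (1 + 2 * t) / P t) = 2 * real (Suc m) * (1 + 2 * t) / P t"
    proof -
      have "r * (4 * k * (1 + 2 * t) / P t) = 4 * (r * k) * (1 + 2 * t) / P t" for k
        by simp
      moreover have "r * (real m + 2) = real (Suc m) / 2" unfolding r_def by (simp add: field_simps)
      ultimately show ?thesis by (simp only:)
    qed
    also have "?y' / ?y + 2 * real (Suc m) * (1 + 2 * t) / P t
        = (P t * ?y' + 2 * real (Suc m) * (1 + 2 * t) * ?y) / (?y * P t)"
      using P[OF t] g[OF t] by (simp add: field_simps)
    \<comment> \<open>The equation trades the first- and zeroth-order terms for the second-order
      term, whose sign is known from convexity.\<close>
    also have "P t * ?y' + 2 * real (Suc m) * (1 + 2 * t) * ?y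
        = - (t * (1 + t) * (1 + 2 * t) * (4 * Grat'' m (1 + 2 * t)))"
    proof -
      have "t * (1 + t) * (1 + 2 * t) * (4 * Grat'' m (1 + 2 * t))
          + (4 * (real (Suc m) + 1) * t * (1 + t) + 1) * ?y' + 2 * real (Suc m) * (1 + 2 * t) * ?y = 0"
        using Grat_ode_on_nonneg[of m] t unfolding G_ode_on_nonneg_def by blast
      moreover have "P t = 4 * (real (Suc m) + 1) * t * (1 + t) + 1" by (simp add: P_def add_ac)
      ultimately show ?thesis by simp
    qed
    finally have "(\<phi> has_real_derivative
        - (t * (1 + t) * (1 + 2 * t) * (4 * Grat'' m (1 + 2 * t))) / (?y * P t)) (at t)" .
    moreover have "- (t * (1 + t) * (1 + 2 * t) * (4 * Grat'' m (1 + 2 * t))) / (?y * P t) \<le> 0"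
      using t P[OF t] g[OF t] Grat''_nonneg[of "1 + 2 * t" m] by (intro divide_nonpos_pos) auto
    ultimately show "\<exists>y. (\<phi> has_real_derivative y) (at t) \<and> y \<le> 0" by blast
  qed
  then have "ln (Grat m (1 + 2 * x)) \<le> - r * ln (P x)"
    by (simp add: \<phi>_def P_def Grat_1)
  then have "Grat m (1 + 2 * x) \<le> exp (- r * ln (P x))"
    using g[OF assms] by (metis exp_le_cancel_iff exp_ln)
  also have "\<dots> = P x powr (- r)"
    using P[OF assms] by (simp add: powr_def)
  finally show ?thesis by (simp add: P_def r_def)
qed

section \<open>Rationality and the Heun equation on the negative axis\<close>

lemma Grat_rational: "rational_on {..<0} (\<lambda>x. Grat m (1 - 2 * x))"
proof -
  define l where "l = [:1, -2 :: real:]"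
  \<comment> \<open>Over the common denominator \<open>l ^ (2 * m + 1)\<close> the
    \<open>j\<close>-th term keeps the exponent \<open>2 * m + 1 - (2 * j + 1)\<close>.\<close>
  define p where "p = (\<Sum>j\<le>m. smult (gcoeff m j) (l ^ (2 * (m - j))))"
  have l: "poly l x = 1 - 2 * x" for x by (simp add: l_def)
  have "Grat m (1 - 2 * x) = poly p x / poly (l ^ (2 * m + 1)) x" if "x < 0" for x
    unfolding Grat_def p_def poly_sum sum_divide_distrib
  proof (rule sum.cong)
    fix j assume "j \<in> {..m}"
    then have e: "2 * m + 1 = 2 * (m - j) + (2 * j + 1)" by auto
    have "1 - 2 * x \<noteq> 0" using that by auto
    then show "gcoeff m j * inverse ((1 - 2 * x) ^ (2 * j + 1))
        = poly (smult (gcoeff m j) (l ^ (2 * (m - j)))) x / poly (l ^ (2 * m + 1)) x"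
      unfolding e power_add[of l] by (simp add: l divide_inverse)
  qed simp
  moreover have "l ^ (2 * m + 1) \<noteq> 0" unfolding l_def power_eq_0_iff by simp
  ultimately show ?thesis
    unfolding rational_on_def by (intro exI[of _ p] exI[of _ "l ^ (2 * m + 1)"]) (auto simp: l)
qed

text \<open>Under \<open>x \<mapsto> - x\<close> the first derivative changes sign, and dividing the
  equation at \<open>- x\<close> by \<open>- x * (x - 1) * (2 * x - 1)\<close> gives the Heun
  form.\<close>

lemma G_ode_reflect:
  assumes "G_ode_on_nonneg n y y' y''"
  shows "has_two_derivs_on {..<0} (\<lambda>x. y (- x)) (\<lambda>x. - y' (- x)) (\<lambda>x. y'' (- x))"
    and "\<And>x. x < 0 \<Longrightarrow> y'' (- x) + (1 / x + 1 / (x - 1) + 2 * real n / (x - 1 / 2)) * (- y' (- x))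
          + (2 * real n * x - real n) / (x * (x - 1) * (x - 1 / 2)) * y (- x) = 0"
proof -
  \<comment> \<open>Derivatives of \<open>y\<close> are given only within \<open>{0..}\<close>;
    negation maps \<open>{..<0}\<close> into that set, so the chain rule is applied within the
    image.\<close>
  have d: "(f \<circ> uminus has_real_derivative - D) (at x within {..<0})"
    if "(f has_real_derivative D) (at (- x) within {0..})" for f D and x :: real
  proof -
    have "(f has_real_derivative D) (at (- x) within uminus ` {..<0})"
      by (rule DERIV_subset[OF that]) auto
    moreover have "(uminus has_real_derivative - 1) (at x within {..<0})"
      by (auto intro!: derivative_eq_intros)
    ultimately show ?thesis using DERIV_image_chain by fastforce
  qed
  show "has_two_derivs_on {..<0} (\<lambda>x. y (- x)) (\<lambda>x. - y' (- x)) (\<lambda>x. y'' (- x))"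
    unfolding has_two_derivs_on_def
  proof (intro ballI conjI)
    fix x :: real assume "x \<in> {..<0}"
    then have "- x \<in> {0..}" by auto
    then have y: "(y has_real_derivative y' (- x)) (at (- x) within {0..})"
      "(y' has_real_derivative y'' (- x)) (at (- x) within {0..})"
      using assms by (auto simp: G_ode_on_nonneg_def has_two_derivs_on_def)
    show "((\<lambda>x. y (- x)) has_real_derivative - y' (- x)) (at x within {..<0})"
      using d[OF y(1)] by (simp add: o_def)
    show "((\<lambda>x. - y' (- x)) has_real_derivative y'' (- x)) (at x within {..<0})"
      using DERIV_minus[OF d[OF y(2)]] by (simp add: o_def)
  qed
  fix x :: real assume x: "x < 0"
  let ?E = "x * (x - 1) * (x - 1 / 2)"
  have ode: "- x * (1 + - x) * (1 + 2 * - x) * y'' (- x)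
      + (4 * (real n + 1) * - x * (1 + - x) + 1) * y' (- x) + 2 * real n * (1 + 2 * - x) * y (- x) = 0"
    using assms x unfolding G_ode_on_nonneg_def by (metis less_le neg_0_le_iff_le)
  have E: "?E \<noteq> 0" using x by auto
  \<comment> \<open>Over the common denominator the numerator is
    \<open>(2 * x - 1)\<^sup>2 + 4 * n * x * (x - 1)\<close>.\<close>
  have drift: "1 / x + 1 / (x - 1) + 2 * real n / (x - 1 / 2)
      = (4 * (real n + 1) * x * (x - 1) + 1) / (2 * ?E)"
    using x by (simp add: divide_simps) (simp add: algebra_simps)
  have "y'' (- x) + (1 / x + 1 / (x - 1) + 2 * real n / (x - 1 / 2)) * (- y' (- x))
      + (2 * real n * x - real n) / ?E * y (- x)
    = (2 * ?E * y'' (- x) - (4 * (real n + 1) * x * (x - 1) + 1) * y' (- x)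
       + 2 * (2 * real n * x - real n) * y (- x)) / (2 * ?E)"
  proof -
    have "u + q / (2 * e) * (- v) + p / e * w = (2 * e * u - q * v + 2 * p * w) / (2 * e)"
      if "e \<noteq> 0" for e u v w p q :: real
      using that by (simp add: field_simps)
    from this[OF E] show ?thesis unfolding drift .
  qed
  \<comment> \<open>The expression is the negative of the left side of \<open>ode\<close>.\<close>
  also have "2 * ?E * y'' (- x) - (4 * (real n + 1) * x * (x - 1) + 1) * y' (- x)
       + 2 * (2 * real n * x - real n) * y (- x) = 0"
  proof -
    have "2 * ?E = x * (x - 1) * (2 * x - 1)" by (simp add: field_simps)
    then show ?thesis using ode by algebra
  qed
  finally show "y'' (- x) + (1 / x + 1 / (x - 1) + 2 * real n / (x - 1 / 2)) * (- y' (- x))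
          + (2 * real n * x - real n) / ?E * y (- x) = 0" by simp
qed

theorem theorem5p1:
  fixes n :: nat
  assumes "n \<ge> 1"
  shows
    "(\<exists>G' G''. has_two_derivs_on {0..} (G n) G' G'' \<and>
        (\<forall>x\<ge>0. x * (1 + x) * (1 + 2 * x) * G'' x
              + (4 * (real n + 1) * x * (1 + x) + 1) * G' x
              + 2 * real n * (1 + 2 * x) * G n x = 0))
     \<and> (\<forall>x\<ge>0. G n x = 1 / pi *
          (LBINT t:{0..1}. (t + (1 - t) * (1 + 2 * x)\<^sup>2) powi (- int n) * (1 / sqrt (t * (1 - t)))))
     \<and> (\<forall>x\<ge>0. G n x \<le>
          (4 * (real n + 1) * x * (1 + x) + 1) powr (- (real n / (2 * (real n + 1)))))
     \<and> (\<exists>y' y''. has_two_derivs_on {..<0} (\<lambda>x. G n (- x)) y' y'' \<and>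
        (\<forall>x<0. y'' x + (1 / x + 1 / (x - 1) + 2 * real n / (x - 1 / 2)) * y' x
              + (2 * real n * x - real n) / (x * (x - 1) * (x - 1 / 2)) * G n (- x) = 0))
     \<and> heun_solution_on {..<0} (1 / 2) 1 (2 * real n) 1 1 (2 * real n) (real n) (\<lambda>x. G n (- x))
     \<and> rational_on {..<0} (\<lambda>x. G n (- x))"
proof (intro conjI)
  obtain m where n: "n = Suc m" using assms by (cases n) auto
  obtain G' G'' where ode: "G_ode_on_nonneg n (G n) G' G''"
    using G_ode[OF assms] by auto
  show "\<exists>G' G''. has_two_derivs_on {0..} (G n) G' G'' \<and>
        (\<forall>x\<ge>0. x * (1 + x) * (1 + 2 * x) * G'' x
              + (4 * (real n + 1) * x * (1 + x) + 1) * G' x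
              + 2 * real n * (1 + 2 * x) * G n x = 0)"
    using ode unfolding G_ode_on_nonneg_def by blast
  show "\<forall>x\<ge>0. G n x = 1 / pi *
      (LBINT t:{0..1}. (t + (1 - t) * (1 + 2 * x)\<^sup>2) powi (- int n) * (1 / sqrt (t * (1 - t))))"
  proof (intro allI impI)
    fix x :: real assume x: "x \<ge> 0"
    then show "G n x = 1 / pi *
      (LBINT t:{0..1}. (t + (1 - t) * (1 + 2 * x)\<^sup>2) powi (- int n) * (1 / sqrt (t * (1 - t))))"
      unfolding n G_eq_Grat[OF x] by (subst arcsine_integral_eq_Grat) auto
  qed
  show "\<forall>x\<ge>0. G n x \<le> (4 * (real n + 1) * x * (1 + x) + 1) powr (- (real n / (2 * (real n + 1))))"
    using Grat_bound by (simp add: n G_eq_Grat add_ac)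
  note reflect = G_ode_reflect[OF ode]
  show heun: "\<exists>y' y''. has_two_derivs_on {..<0} (\<lambda>x. G n (- x)) y' y'' \<and>
        (\<forall>x<0. y'' x + (1 / x + 1 / (x - 1) + 2 * real n / (x - 1 / 2)) * y' x
              + (2 * real n * x - real n) / (x * (x - 1) * (x - 1 / 2)) * G n (- x) = 0)"
    using reflect by (intro exI[of _ "\<lambda>x. - G' (- x)"] exI[of _ "\<lambda>x. G'' (- x)"]) blast
  \<comment> \<open>The parameter relation reads \<open>1 + 1 + 2 * n = 1 + 2 * n + 1\<close>, and
    0, 1 and 1/2 all lie outside \<open>{..<0}\<close>.\<close>
  then show "heun_solution_on {..<0} (1 / 2) 1 (2 * real n) 1 1 (2 * real n) (real n) (\<lambda>x. G n (- x))"
    unfolding heun_solution_on_def by auto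
  show "rational_on {..<0} (\<lambda>x. G n (- x))"
    using Grat_rational[of m] by (simp add: rational_on_def n G_eq_Grat)
qed

end
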